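(* Let $(a_n)_{n\ge0}$ be the sequence, listed in increasing order, of the non-negative integers $m$ such that $840m+529$ is a perfect square. Define $t(n)=0$ if $n\equiv 0,2,3,6,9,12,13,15 \pmod{16}$ and $t(n)=1$ otherwise. Then $$\sum_{n=0}^\infty(-1)^{t(n)}q^{a_n}=\frac{(q,q^6,q^7;q^7)_\infty}{(q^2,q^3;q^5)_\infty}.$$
   Context: Here $q$ is a complex number with $|q|<1$ (equivalently, the identity may be read as an identity of formal power series in $q$). For a complex number $a$, $(a;q)_\infty:=\prod_{i=0}^\infty(1-aq^i)$, and $(a_1,a_2,\dots,a_m;q)_\infty:=\prod_{j=1}^m(a_j;q)_\infty$. *)

theory Defs
  imports "HOL-Analysis.Analysis" "HOL-Computational_Algebra.Nth_Powers"
begin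

definition qpoch_inf :: "complex \<Rightarrow> complex \<Rightarrow> complex" where
  "qpoch_inf a q = (\<Prod>i. 1 - a * q ^ i)"

definition qpochs_inf :: "complex list \<Rightarrow> complex \<Rightarrow> complex" where
  "qpochs_inf as q = (\<Prod>a\<leftarrow>as. qpoch_inf a q)"

lemma convergent_prod_qpoch_inf:
  fixes a q :: complex
  assumes "norm q < 1"
  shows "convergent_prod (\<lambda>i. 1 - a * q ^ i)"
proof -
  have "summable (\<lambda>i. norm (- (a * q ^ i)))"
    using assms by (simp add: norm_mult norm_power summable_mult summable_geometric)
  hence "abs_convergent_prod (\<lambda>i. 1 + - (a * q ^ i))"
    by (intro summable_imp_abs_convergent_prod) simp
  thus ?thesis
    by (simp add: abs_convergent_prod_imp_convergent_prod)
qed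

definition square_indices :: "nat set" where
  "square_indices = {m. is_square (840 * m + 529)}"

lemma infinite_square_indices: "infinite square_indices"
proof -
  have "is_square (840 * (840 * j\<^sup>2 + 46 * j) + 529)" for j :: nat
    by (rule is_nth_powerI[where y = "840 * j + 23"]) (simp add: power2_eq_square algebra_simps)
  hence "range (\<lambda>j::nat. 840 * j\<^sup>2 + 46 * j) \<subseteq> square_indices"
    by (auto simp: square_indices_def)
  moreover have "strict_mono (\<lambda>j::nat. 840 * j\<^sup>2 + 46 * j)"
    by (rule strict_monoI) (intro add_strict_mono mult_strict_left_mono power_strict_mono; simp)
  hence "infinite (range (\<lambda>j::nat. 840 * j\<^sup>2 + 46 * j))"
    by (intro range_inj_infinite strict_mono_imp_inj_on)
  ultimately show ?thesis
    using infinite_super by blast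
qed

definition a_seq :: "nat \<Rightarrow> nat" where
  "a_seq n = enumerate square_indices n"

lemma strict_mono_a_seq: "strict_mono a_seq"
  unfolding a_seq_def using infinite_square_indices by (simp add: strict_mono_def)

lemma range_a_seq: "range a_seq = square_indices"
  unfolding a_seq_def using infinite_square_indices by (simp add: range_enumerate)

definition t_sign :: "nat \<Rightarrow> nat" where
  "t_sign n = (if n mod 16 \<in> {0, 2, 3, 6, 9, 12, 13, 15} then 0 else 1)"

end

theory Submission
  imports Defs "HOL-Library.Nat_Bijection"
begin

text \<open>
  Write \<open>J\<^sub>5 = (q, q\<^sup>4, q\<^sup>5; q\<^sup>5)\<^sub>\<infinity>\<close> and \<open>J\<^sub>7 = (q, q\<^sup>6, q\<^sup>7; q\<^sup>7)\<^sub>\<infinity>\<close>. Since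
  \<open>(q; q)\<^sub>\<infinity> = J\<^sub>5 (q\<^sup>2, q\<^sup>3; q\<^sup>5)\<^sub>\<infinity>\<close>, the claim is that \<open>J\<^sub>5 J\<^sub>7\<close> is \<open>(q; q)\<^sub>\<infinity>\<close> times the
  unary theta series. By the Jacobi triple product, \<open>J\<^sub>5 J\<^sub>7\<close> is a signed sum of
  \<open>q\<close> to the power \<open>(21 X\<^sup>2 + 15 Y\<^sup>2 - 564) / 840\<close>, and \<open>W = (7 X - 5 Y) / 2\<close>, \<open>Z = (X + Y) / 2\<close>
  turn this form into \<open>W\<^sup>2 + 35 Z\<^sup>2\<close>, a norm form of \<open>\<rat>(\<surd>-35)\<close>. Multiplication by the norm-one element
  \<open>(1 - \<surd>-35) / 6\<close> preserves the form and maps the lattice \<open>W \<equiv> Z (mod 6)\<close> to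
  \<open>W \<equiv> -Z (mod 6)\<close>. With \<open>h(W, Z) = \<plusminus>\<chi>\<^sub>4(W) \<chi>\<^sub>4(Z)\<close>, the signs occurring in \<open>J\<^sub>5 J\<^sub>7\<close> are exactly
  the difference of \<open>h\<close> and its translate under this map. Hence \<open>J\<^sub>5 J\<^sub>7\<close> is a double sum of \<open>h\<close>, in which,
  for each fixed \<open>W\<close>, the sum over \<open>Z\<close> vanishes or is \<open>\<plusminus>(q; q)\<^sub>\<infinity>\<close> by the pentagonal number
  theorem.
\<close>

section \<open>The Jacobi triple product\<close>

definition qfact :: "complex \<Rightarrow> nat \<Rightarrow> complex" where
  "qfact p m = (\<Prod>i<m. 1 - p * p ^ i)"

lemma qfact_0 [simp]: "qfact p 0 = 1"
  and qfact_Suc: "qfact p (Suc m) = qfact p m * (1 - p * p ^ m)"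
  by (simp_all add: qfact_def)

lemma norm_mult_power_less_1:
  fixes p :: complex
  assumes "norm p < 1"
  shows "norm (p * p ^ i) < 1"
  using assms power_Suc_less_one[of "norm p" i]
  by (cases "p = 0") (auto simp: norm_mult norm_power)

lemma one_minus_mult_power_nonzero:
  fixes p :: complex
  assumes "norm p < 1"
  shows "1 - p * p ^ i \<noteq> 0"
  using norm_mult_power_less_1[OF assms, of i] by auto

lemma qfact_nonzero: "norm p < 1 \<Longrightarrow> qfact p m \<noteq> 0"
  using one_minus_mult_power_nonzero by (auto simp: qfact_def)

lemma LIMSEQ_qpoch_inf:
  assumes "norm q < 1"
  shows "(\<lambda>n. \<Prod>i<n. 1 - a * q ^ i) \<longlonglongrightarrow> qpoch_inf a q"
  unfolding qpoch_inf_def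
  using has_prod_imp_tendsto'[OF convergent_prod_has_prod[OF convergent_prod_qpoch_inf[OF assms, of a]]] .

lemma qpoch_inf_nonzero:
  assumes "norm q < 1" "\<And>i. a * q ^ i \<noteq> 1"
  shows "qpoch_inf a q \<noteq> 0"
  unfolding qpoch_inf_def
  by (rule prodinf_nonzero) (use convergent_prod_qpoch_inf[OF assms(1)] assms(2) in auto)

lemma LIMSEQ_qfact: "norm p < 1 \<Longrightarrow> qfact p \<longlonglongrightarrow> qpoch_inf p p"
  using LIMSEQ_qpoch_inf[of p p] unfolding qfact_def by simp

lemma qpoch_inf_self_nonzero: "norm p < 1 \<Longrightarrow> qpoch_inf p p \<noteq> 0"
  using one_minus_mult_power_nonzero by (intro qpoch_inf_nonzero) auto

text \<open>The central Gaussian binomial coefficient \<open>[2n, n+k]\<close> in base \<open>p\<close>.\<close>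

definition gauss_central :: "complex \<Rightarrow> nat \<Rightarrow> int \<Rightarrow> complex" where
  "gauss_central p n k =
     (if \<bar>k\<bar> \<le> int n then qfact p (2 * n) / (qfact p (nat (int n - k)) * qfact p (nat (int n + k)))
      else 0)"

text \<open>General term of Ramanujan's theta function f(a, b). Both triangular exponents are
  non-negative for every integer k, so \<open>nat\<close> loses nothing.\<close>

definition theta_term :: "complex \<Rightarrow> complex \<Rightarrow> int \<Rightarrow> complex" where
  "theta_term a b k = a ^ nat (k * (k + 1) div 2) * b ^ nat (k * (k - 1) div 2)"

lemma gauss_central_nat:
  assumes "int i = int n - k" "int j = int n + k"
  shows "gauss_central p n k = qfact p (2 * n) / (qfact p i * qfact p j)"
  using assms unfolding gauss_central_def
  by (metis (no_types, lifting) abs_le_iff diff_ge_0_iff_ge minus_le_iff nat_int of_nat_0_le_iff add.commute diff_minus_eq_add)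

text \<open>Two applications of the q-Pascal rule lead from row 2n to row 2n + 2. The exponents n +
  1 - k and n + 1 + k are non-negative wherever the coefficient next to them is nonzero.\<close>

lemma gauss_central_Suc:
  assumes "norm p < 1"
  shows "gauss_central p (Suc n) k =
           (1 + p * p ^ (2 * n)) * gauss_central p n k
           + p ^ nat (int n + 1 - k) * gauss_central p n (k - 1)
           + p ^ nat (int n + 1 + k) * gauss_central p n (k + 1)"
proof -
  note nz = qfact_nonzero[OF assms] one_minus_mult_power_nonzero[OF assms]
  consider "\<bar>k\<bar> \<le> int n" | "k = int n + 1" | "k = - (int n + 1)" | "\<bar>k\<bar> > int n + 1"
    by linarith
  then show ?thesis
  proof cases
    case 1
    define i j where "i = nat (int n - k)" and "j = nat (int n + k)"
    have ij: "int i = int n - k" "int j = int n + k" and n: "2 * n = i + j"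
      using 1 by (auto simp: i_def j_def)
    have e: "nat (int n + 1 - k) = Suc i" "nat (int n + 1 + k) = Suc j"
      using ij by auto
    \<comment> \<open>For j = 0 the index k - 1 leaves the range: the default value 0 agrees with
      the vanishing factor 1 - p^j. The same happens in \<open>up\<close> for i = 0.\<close>
    have down: "gauss_central p n (k - 1) = qfact p (2 * n) * (1 - p ^ j) / (qfact p (Suc i) * qfact p j)"
    proof (cases j)
      case 0
      then show ?thesis using ij by (simp add: gauss_central_def)
    next
      case (Suc j')
      then show ?thesis
        using gauss_central_nat[of "Suc i" n "k - 1" j' p] ij nz by (simp add: qfact_Suc)
    qed
    have up: "gauss_central p n (k + 1) = qfact p (2 * n) * (1 - p ^ i) / (qfact p i * qfact p (Suc j))"
    proof (cases i)
      case 0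
      then show ?thesis using ij by (simp add: gauss_central_def)
    next
      case (Suc i')
      then show ?thesis
        using gauss_central_nat[of i' n "k + 1" "Suc j" p] ij nz by (simp add: qfact_Suc)
    qed
    have mid: "gauss_central p n k = qfact p (2 * n) / (qfact p i * qfact p j)"
      using ij by (intro gauss_central_nat) auto
    have new: "gauss_central p (Suc n) k = qfact p (2 * Suc n) / (qfact p (Suc i) * qfact p (Suc j))"
      using ij by (intro gauss_central_nat) auto
    define x y where "x = p ^ i" and "y = p ^ j"
    have pw: "p ^ (n * 2) = p ^ i * p ^ j"
      using n by (simp add: mult.commute flip: power_add)
    have xy: "1 - p * x \<noteq> 0" "1 - p * y \<noteq> 0"
      using nz by (auto simp: x_def y_def)
    \<comment> \<open>With the powers and factorials abstracted to variables, the recurrence is an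
      identity of rational functions.\<close>
    have *: "c * ((1 - p * (x * y)) * (1 - p * (p * (x * y)))) / (f * (1 - p * x) * (g * (1 - p * y)))
        = (1 + p * (x * y)) * (c / (f * g)) + p * x * (c * (1 - y) / (f * (1 - p * x) * g))
          + p * y * (c * (1 - x) / (f * (g * (1 - p * y))))"
      if "f \<noteq> 0" "g \<noteq> 0" for c f g
      using that xy by (simp add: divide_simps) (simp add: algebra_simps)
    show ?thesis
      unfolding e down up mid new
      using *[of "qfact p i" "qfact p j" "qfact p (2 * n)"] nz
      by (simp add: qfact_Suc pw x_def y_def mult_ac)
  next
    case 2
    have "gauss_central p (Suc n) k = 1" "gauss_central p n (k - 1) = 1"
      using gauss_central_nat[of 0 "Suc n" k "2 * Suc n" p] gauss_central_nat[of 0 n "k - 1" "2 * n" p] nz 2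
      by auto
    then show ?thesis using 2 by (simp add: gauss_central_def)
  next
    case 3
    have "gauss_central p (Suc n) k = 1" "gauss_central p n (k + 1) = 1"
      using gauss_central_nat[of "2 * Suc n" "Suc n" k 0 p] gauss_central_nat[of "2 * n" n "k + 1" 0 p] nz 3
      by auto
    then show ?thesis using 3 by (simp add: gauss_central_def)
  next
    case 4
    then have "\<not> \<bar>k - 1\<bar> \<le> int n" "\<not> \<bar>k + 1\<bar> \<le> int n" by linarith+
    with 4 show ?thesis by (simp add: gauss_central_def)
  qed
qed

text \<open>The bounds are the inequalities k(k+1) \<ge> 0, k(k-1) \<ge> 0 and (k+1)(k+2) \<ge> 0
  rewritten in terms of u; they control truncation when exponents pass from \<open>int\<close> to
  \<open>nat\<close>.\<close>

lemma triangular_int: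
  obtains u :: int where "k * (k + 1) = 2 * u" "u \<ge> 0" "u \<ge> k" "u + k \<ge> -1"
proof -
  have "even (k * (k + 1))" by simp
  then obtain u where u: "k * (k + 1) = 2 * u" by (elim evenE)
  have "0 \<le> k * (k + 1)" by (cases "k \<ge> 0") (auto intro: mult_nonpos_nonpos)
  moreover have "0 \<le> k * (k - 1)" by (cases "k \<ge> 1") (auto intro: mult_nonpos_nonpos)
  moreover have "0 \<le> (k + 1) * (k + 2)" by (cases "k \<ge> -1") (auto intro: mult_nonpos_nonpos)
  ultimately show ?thesis using u by (intro that[of u]) (auto simp: algebra_simps)
qed

text \<open>Consecutive theta terms have the formal ratio a^k b^(k-1). Multiplying through by
  (ab)^(n+1-k) leaves only non-negative exponents, so a or b may be zero.\<close>

lemma theta_term_shift: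
  assumes "k \<le> int n + 1"
  shows "a * (a * b) ^ n * theta_term a b (k - 1) = (a * b) ^ nat (int n + 1 - k) * theta_term a b k"
proof -
  have e1: "nat (int n + 1 - k) + nat (k * (k + 1) div 2) = Suc n + nat ((k - 1) * k div 2)"
   and e2: "nat (int n + 1 - k) + nat (k * (k - 1) div 2) = n + nat ((k - 1) * (k - 2) div 2)"
  proof -
    obtain u where "(k - 1) * (k - 1 + 1) = 2 * u" "u \<ge> 0" "u \<ge> k - 1" "u + (k - 1) \<ge> -1"
      by (rule triangular_int)
    then have u: "(k - 1) * k = 2 * u" "u \<ge> 0" "u \<ge> k - 1" "u + k \<ge> 0" by auto
    have v: "k * (k + 1) = 2 * (u + k)" "k * (k - 1) = 2 * u" "(k - 1) * (k - 2) = 2 * (u - k + 1)"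
      using u(1) by (auto simp: algebra_simps)
    show "nat (int n + 1 - k) + nat (k * (k + 1) div 2) = Suc n + nat ((k - 1) * k div 2)"
      "nat (int n + 1 - k) + nat (k * (k - 1) div 2) = n + nat ((k - 1) * (k - 2) div 2)"
      unfolding v u(1) using u assms by auto
  qed
  have "a * (a * b) ^ n * theta_term a b (k - 1)
      = a ^ (Suc n + nat ((k - 1) * k div 2)) * b ^ (n + nat ((k - 1) * (k - 2) div 2))"
    by (simp add: theta_term_def power_add power_mult_distrib mult_ac)
  also have "\<dots> = (a * b) ^ nat (int n + 1 - k) * theta_term a b k"
    unfolding e1[symmetric] e2[symmetric]
    by (simp add: theta_term_def power_add power_mult_distrib mult_ac)
  finally show ?thesis .
qed

lemma theta_term_uminus: "theta_term a b (- k) = theta_term b a k"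
proof -
  have "- k * (- k + 1) = k * (k - 1)" "- k * (- k - 1) = k * (k + 1)" by (auto simp: algebra_simps)
  then show ?thesis unfolding theta_term_def by (simp only: mult_ac)
qed

lemma theta_term_shift':
  assumes "- k \<le> int n + 1"
  shows "b * (a * b) ^ n * theta_term a b (k + 1) = (a * b) ^ nat (int n + 1 + k) * theta_term a b k"
  using theta_term_shift[OF assms, of b a] theta_term_uminus[of b a "k + 1"] theta_term_uminus[of b a k]
  by (simp add: mult_ac)

text \<open>With p = ab, the new factor (1 + a p^n)(1 + b p^n) equals (1 + p^(2n+1)) + a p^n + b
  p^n. These three parts match the three terms of \<open>gauss_central_Suc\<close> once the theta
  terms are shifted.\<close>

lemma finite_jacobi_triple_product:
  fixes a b :: complex
  assumes "norm (a * b) < 1"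
  shows "((\<lambda>k. gauss_central (a * b) n k * theta_term a b k) has_sum
           ((\<Prod>i<n. 1 + a * (a * b) ^ i) * (\<Prod>i<n. 1 + b * (a * b) ^ i))) UNIV"
proof (induction n)
  case 0
  show ?case
    by (rule has_sum_finite_neutralI[where B = "{0}"]) (auto simp: gauss_central_def theta_term_def)
next
  case (Suc n)
  define p where "p = a * b"
  define P where "P = (\<Prod>i<n. 1 + a * (a * b) ^ i) * (\<Prod>i<n. 1 + b * (a * b) ^ i)"
  define f where "f k = gauss_central p n k * theta_term a b k" for k
  have f: "(f has_sum P) UNIV"
    using Suc by (simp add: f_def[abs_def] P_def p_def)
  have f_down: "((\<lambda>k. f (k - 1)) has_sum P) UNIV"
    using f by (subst has_sum_reindex_bij_witness[of UNIV "\<lambda>k. k + 1" "\<lambda>k. k - 1" _ f]) auto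
  have f_up: "((\<lambda>k. f (k + 1)) has_sum P) UNIV"
    using f by (subst has_sum_reindex_bij_witness[of UNIV "\<lambda>k. k - 1" "\<lambda>k. k + 1" _ f]) auto
  have "gauss_central p (Suc n) k * theta_term a b k =
          (1 + p * p ^ (2 * n)) * f k + a * p ^ n * f (k - 1) + b * p ^ n * f (k + 1)" for k
  proof -
    have down: "p ^ nat (int n + 1 - k) * gauss_central p n (k - 1) * theta_term a b k = a * p ^ n * f (k - 1)"
    proof (cases "k \<le> int n + 1")
      case True
      show ?thesis
        using theta_term_shift[OF True, of a b] by (simp add: f_def p_def mult_ac)
    qed (simp add: f_def gauss_central_def)
    have up: "p ^ nat (int n + 1 + k) * gauss_central p n (k + 1) * theta_term a b k = b * p ^ n * f (k + 1)"
    proof (cases "- k \<le> int n + 1")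
      case True
      show ?thesis
        using theta_term_shift'[OF True, of b a] by (simp add: f_def p_def mult_ac)
    qed (simp add: f_def gauss_central_def)
    show ?thesis
      unfolding gauss_central_Suc[OF assms[folded p_def]] distrib_right down up by (simp add: f_def)
  qed
  moreover have "((\<lambda>k. (1 + p * p ^ (2 * n)) * f k + a * p ^ n * f (k - 1) + b * p ^ n * f (k + 1))
      has_sum ((1 + p * p ^ (2 * n)) * P + a * p ^ n * P + b * p ^ n * P)) UNIV"
    by (intro has_sum_add has_sum_cmult_right f f_down f_up)
  moreover have "(1 + p * p ^ (2 * n)) * P + a * p ^ n * P + b * p ^ n * P =
      (\<Prod>i<Suc n. 1 + a * (a * b) ^ i) * (\<Prod>i<Suc n. 1 + b * (a * b) ^ i)"
    by (simp add: P_def p_def algebra_simps power_mult power2_eq_square power_mult_distrib)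
  ultimately show ?case by (simp add: p_def)
qed

section \<open>Passage to the limit in the finite triple product\<close>

lemma summable_on_power_abs_int:
  fixes r :: real
  assumes "0 \<le> r" "r < 1"
  shows "(\<lambda>k::int. r ^ nat \<bar>k\<bar>) summable_on UNIV"
proof -
  have geo: "(\<lambda>n. r ^ n) summable_on UNIV"
    using assms by (subst summable_on_UNIV_nonneg_real_iff) (auto intro: summable_geometric)
  have "(\<lambda>k::int. r ^ nat \<bar>k\<bar>) summable_on {0..}"
    using geo by (subst summable_on_reindex_bij_witness[of _ int nat UNIV "\<lambda>n. r ^ n"]) auto
  moreover have "(\<lambda>k::int. r ^ nat \<bar>k\<bar>) summable_on {..0}"
    using geo
    by (subst summable_on_reindex_bij_witness[of _ "\<lambda>n. - int n" "\<lambda>k. nat (- k)" UNIV "\<lambda>n. r ^ n"]) auto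
  ultimately have "(\<lambda>k::int. r ^ nat \<bar>k\<bar>) summable_on ({0..} \<union> {..0})"
    by (rule summable_on_union)
  also have "{0..} \<union> {..0} = (UNIV :: int set)" by auto
  finally show ?thesis .
qed

text \<open>The two exponents add up to k^2, which is at least |k|.\<close>

lemma norm_theta_term_le:
  assumes "norm a \<le> r" "norm b \<le> r" "r \<le> 1"
  shows "norm (theta_term a b k) \<le> r ^ nat \<bar>k\<bar>"
proof -
  have r: "0 \<le> r" using assms(1) norm_ge_zero order_trans by blast
  obtain u where "k * (k + 1) = 2 * u" "u \<ge> 0" "u \<ge> k" "u + k \<ge> -1" by (rule triangular_int)
  moreover obtain v where v: "k * (k - 1) = 2 * v" "v \<ge> 0"
    using triangular_int[of "k - 1"] by (metis diff_add_cancel mult.commute)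
  moreover have "u = v + k" using calculation by (simp add: algebra_simps)
  ultimately have uv: "k * (k + 1) = 2 * u" "k * (k - 1) = 2 * v" "u \<ge> 0" "v \<ge> 0" "u + v \<ge> \<bar>k\<bar>"
    by auto
  have "norm (theta_term a b k) = norm a ^ nat u * norm b ^ nat v"
    by (simp add: theta_term_def uv(1,2) norm_mult norm_power)
  also have "\<dots> \<le> r ^ nat u * r ^ nat v"
    using assms r by (intro mult_mono power_mono) auto
  also have "\<dots> = r ^ (nat u + nat v)" by (simp add: power_add)
  also have "\<dots> \<le> r ^ nat \<bar>k\<bar>"
    using uv r assms by (intro power_decreasing) auto
  finally show ?thesis .
qed

text \<open>As n grows, the central Gaussian binomials tend to 1 / (p; p)_inf. They are bounded
  uniformly because \<open>qfact p\<close> and its inverse converge, so dominated convergence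
  applies to the finite identity.\<close>

theorem jacobi_triple_product:
  fixes a b :: complex
  assumes "norm a < 1" "norm b < 1"
  shows "(theta_term a b has_sum
           (qpoch_inf (- a) (a * b) * qpoch_inf (- b) (a * b) * qpoch_inf (a * b) (a * b))) UNIV"
proof -
  define p where "p = a * b"
  define r where "r = max (norm a) (norm b)"
  have r: "norm a \<le> r" "norm b \<le> r" "r < 1" "0 \<le> r" using assms by (auto simp: r_def le_max_iff_disj)
  have p: "norm p < 1"
    using assms mult_strict_mono[of "norm a" 1 "norm b" 1] by (auto simp: p_def norm_mult)
  define L where "L = qpoch_inf p p"
  have L: "L \<noteq> 0" "qfact p \<longlonglongrightarrow> L"
    using qpoch_inf_self_nonzero[OF p] LIMSEQ_qfact[OF p] by (auto simp: L_def)
  obtain A where A: "\<And>n. norm (qfact p n) \<le> A" "A > 0"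
    using convergent_imp_Bseq[OF convergentI[OF L(2)]] by (auto simp: Bseq_def)
  have "(\<lambda>n. inverse (qfact p n)) \<longlonglongrightarrow> inverse L" using L by (intro tendsto_intros)
  then have "Bseq (\<lambda>n. inverse (qfact p n))" by (intro convergent_imp_Bseq convergentI)
  then obtain B where B: "\<And>n. norm (inverse (qfact p n)) \<le> B" "B > 0"
    by (auto simp: Bseq_def)
  have bound: "norm (gauss_central p n k) \<le> A * (B * B)" for n k
  proof (cases "\<bar>k\<bar> \<le> int n")
    case True
    then have "norm (gauss_central p n k) = norm (qfact p (2 * n)) *
        (norm (inverse (qfact p (nat (int n - k)))) * norm (inverse (qfact p (nat (int n + k)))))"
      by (simp add: gauss_central_def norm_mult norm_divide norm_inverse field_simps)
    also have "\<dots> \<le> A * (B * B)"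
      using A B by (intro mult_mono) (auto simp: less_imp_le)
    finally show ?thesis .
  qed (use A B in \<open>auto simp: gauss_central_def\<close>)
  have lim: "(\<lambda>n. gauss_central p n k) \<longlonglongrightarrow> 1 / L" for k
  proof -
    have ev: "eventually (\<lambda>n. gauss_central p n k =
      qfact p (2 * n) / (qfact p (nat (int n - k)) * qfact p (nat (int n + k)))) sequentially"
      using eventually_ge_at_top[of "nat \<bar>k\<bar>"] by eventually_elim (auto simp: gauss_central_def)
    have sub: "filterlim (\<lambda>n. 2 * n) at_top (sequentially :: nat filter)"
      "filterlim (\<lambda>n. nat (int n - k)) at_top sequentially"
      "filterlim (\<lambda>n. nat (int n + k)) at_top sequentially"
    proof -
      show "filterlim (\<lambda>n. 2 * n) at_top (sequentially :: nat filter)"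
        by (intro filterlim_at_top_mono[OF filterlim_ident]) auto
      show "filterlim (\<lambda>n. nat (int n - k)) at_top sequentially"
        unfolding filterlim_at_top
      proof
        show "\<forall>\<^sub>F n in sequentially. Z \<le> nat (int n - k)" for Z
          by (rule eventually_mono[OF eventually_ge_at_top[of "Z + nat \<bar>k\<bar>"]]) auto
      qed
      show "filterlim (\<lambda>n. nat (int n + k)) at_top sequentially"
        unfolding filterlim_at_top
      proof
        show "\<forall>\<^sub>F n in sequentially. Z \<le> nat (int n + k)" for Z
          by (rule eventually_mono[OF eventually_ge_at_top[of "Z + nat \<bar>k\<bar>"]]) auto
      qed
    qed
    have "(\<lambda>n. qfact p (2 * n) / (qfact p (nat (int n - k)) * qfact p (nat (int n + k))))
        \<longlonglongrightarrow> L / (L * L)"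
      using L(1) sub[THEN filterlim_compose[OF L(2)]] by (intro tendsto_intros) auto
    then show ?thesis using L(1) ev by (simp add: tendsto_cong)
  qed
  \<comment> \<open>Tannery's theorem concerns series over the naturals; \<open>int_decode\<close>
    enumerates the integers.\<close>
  define f where "f m n = gauss_central p n (int_decode m) * theta_term a b (int_decode m)" for m n
  define M where "M m = A * (B * B) * r ^ nat \<bar>int_decode m\<bar>" for m
  have f_le: "norm (f m n) \<le> M m" for m n
    unfolding f_def M_def norm_mult
    using bound norm_theta_term_le[of a r b] r A B by (intro mult_mono) auto
  have "(\<lambda>m. r ^ nat \<bar>int_decode m\<bar>) summable_on UNIV"
    using summable_on_power_abs_int[OF r(4,3)]
    by (subst summable_on_reindex_bij_betw[OF bij_int_decode, of "\<lambda>k. r ^ nat \<bar>k\<bar>"])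
  then have M: "summable M"
    unfolding M_def by (intro summable_mult summable_on_imp_summable)
  have tannery: "(\<lambda>n. suminf (\<lambda>m. f m n)) \<longlonglongrightarrow> suminf (\<lambda>m. 1 / L * theta_term a b (int_decode m))"
  proof (rule tannerys_theorem[THEN conjunct2, THEN conjunct2])
    show "(\<lambda>n. f m n) \<longlonglongrightarrow> 1 / L * theta_term a b (int_decode m)" for m
      unfolding f_def by (intro tendsto_mult lim tendsto_const)
    show "eventually (\<lambda>(m, n). norm (f m n) \<le> M m) (at_top \<times>\<^sub>F sequentially)"
      by (simp add: f_le case_prod_unfold)
  qed (use M in auto)
  define P where "P n = (\<Prod>i<n. 1 + a * p ^ i) * (\<Prod>i<n. 1 + b * p ^ i)" for n
  have "suminf (\<lambda>m. f m n) = P n" for n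
  proof -
    have "((\<lambda>k. gauss_central p n k * theta_term a b k) has_sum P n) UNIV"
      using finite_jacobi_triple_product[of a b n] p by (simp add: p_def P_def)
    then have "((\<lambda>m. f m n) has_sum P n) UNIV"
      unfolding f_def
      by (subst has_sum_reindex_bij_betw[OF bij_int_decode, of "\<lambda>k. gauss_central p n k * theta_term a b k"])
    then show ?thesis by (intro sums_unique[symmetric] has_sum_imp_sums)
  qed
  moreover have "P \<longlonglongrightarrow> qpoch_inf (- a) p * qpoch_inf (- b) p"
    unfolding P_def using tendsto_mult[OF LIMSEQ_qpoch_inf[OF p, of "- a"] LIMSEQ_qpoch_inf[OF p, of "- b"]]
    by simp
  moreover have theta: "theta_term a b summable_on UNIV"
    by (rule abs_summable_summable, rule Infinite_Sum.abs_summable_on_comparison_test'[OF summable_on_power_abs_int[OF r(4,3)]])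
      (use norm_theta_term_le r in auto)
  define S where "S = infsum (theta_term a b) UNIV"
  have S: "(theta_term a b has_sum S) UNIV" using theta by (simp add: S_def)
  then have "((\<lambda>m. theta_term a b (int_decode m)) has_sum S) UNIV"
    by (subst has_sum_reindex_bij_betw[OF bij_int_decode, of "theta_term a b"])
  then have "((\<lambda>m. 1 / L * theta_term a b (int_decode m)) has_sum (1 / L * S)) UNIV"
    by (rule has_sum_cmult_right)
  then have "suminf (\<lambda>m. 1 / L * theta_term a b (int_decode m)) = 1 / L * S"
    by (intro sums_unique[symmetric] has_sum_imp_sums)
  ultimately have "1 / L * S = qpoch_inf (- a) p * qpoch_inf (- b) p"
    using tannery LIMSEQ_unique by auto
  then show ?thesis using S L(1) by (simp add: p_def L_def field_simps)
qed

section \<open>Product series, dissection and the pentagonal number theorem\<close>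

lemma has_sum_mult_Times:
  fixes f g :: "_ \<Rightarrow> complex"
  assumes f: "(f has_sum S) A" and g: "(g has_sum T) B"
  shows "((\<lambda>(x, y). f x * g y) has_sum S * T) (A \<times> B)"
proof (rule has_sum_SigmaI)
  show "((\<lambda>y. case (x, y) of (x, y) \<Rightarrow> f x * g y) has_sum f x * T) B" for x
    using g by (simp add: has_sum_cmult_right)
  show "((\<lambda>x. f x * T) has_sum S * T) A"
    using f by (rule has_sum_cmult_left)
  \<comment> \<open>Unconditional summability of complex families is absolute, which makes the
    product family summable.\<close>
  have "(\<lambda>x. norm (f x)) summable_on A" "(\<lambda>y. norm (g y)) summable_on B"
    using f g summable_on_iff_abs_summable_on_complex has_sum_imp_summable by blast+
  then have "(\<lambda>z. norm (case z of (x, y) \<Rightarrow> f x * g y)) summable_on A \<times> B"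
    by (subst Infinite_Sum.abs_summable_on_Sigma_iff)
       (auto simp: norm_mult infsum_cmult_right' infsum_nonneg intro!: summable_on_cmult_left summable_on_cmult_right)
  then show "(\<lambda>(x, y). f x * g y) summable_on A \<times> B"
    by (rule abs_summable_summable)
qed

text \<open>Sorts the factors by their index modulo m; partial products of length n * m split
  exactly.\<close>

lemma qpoch_inf_dissect:
  assumes "norm q < 1" "m > 0"
  shows "qpoch_inf a q = (\<Prod>j<m. qpoch_inf (a * q ^ j) (q ^ m))"
proof (rule LIMSEQ_unique)
  have qm: "norm (q ^ m) < 1"
    using assms norm_mult_power_less_1[of q "m - 1"] by (simp flip: power_Suc)
  have split: "(\<Prod>i<n * m. 1 - a * q ^ i) = (\<Prod>j<m. \<Prod>i<n. 1 - a * q ^ j * (q ^ m) ^ i)" for n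
  proof -
    have "(\<Prod>i<n * m. 1 - a * q ^ i) = (\<Prod>i<n. \<Prod>k=i*m..<i*m+m. 1 - a * q ^ k)"
      by (rule prod.nat_group[symmetric])
    also have "\<dots> = (\<Prod>i<n. \<Prod>j<m. 1 - a * q ^ j * (q ^ m) ^ i)"
    proof (rule prod.cong[OF refl])
      fix i
      have "(\<Prod>k=i*m..<i*m+m. 1 - a * q ^ k) = (\<Prod>j<m. 1 - a * q ^ (j + i * m))"
        using prod.shift_bounds_nat_ivl[of "\<lambda>k. 1 - a * q ^ k" 0 "i * m" m]
        by (simp add: atLeast0LessThan add.commute)
      also have "\<dots> = (\<Prod>j<m. 1 - a * q ^ j * (q ^ m) ^ i)"
        by (simp add: power_add mult_ac flip: power_mult)
      finally show "(\<Prod>k=i*m..<i*m+m. 1 - a * q ^ k) = \<dots>" .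
    qed
    also have "\<dots> = (\<Prod>j<m. \<Prod>i<n. 1 - a * q ^ j * (q ^ m) ^ i)"
      by (rule prod.swap)
    finally show ?thesis .
  qed
  have "filterlim (\<lambda>n. n * m) at_top sequentially"
    using assms(2) by (intro filterlim_at_top_mono[OF filterlim_ident]) auto
  from filterlim_compose[OF LIMSEQ_qpoch_inf[OF assms(1)] this]
  show "(\<lambda>n. \<Prod>i<n * m. 1 - a * q ^ i) \<longlonglongrightarrow> qpoch_inf a q" .
  show "(\<lambda>n. \<Prod>i<n * m. 1 - a * q ^ i) \<longlonglongrightarrow> (\<Prod>j<m. qpoch_inf (a * q ^ j) (q ^ m))"
    unfolding split by (intro tendsto_prod LIMSEQ_qpoch_inf qm)
qed

definition alt_sign :: "int \<Rightarrow> complex" where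
  "alt_sign k = (if even k then 1 else -1)"

text \<open>The two triangular numbers differ by k, so the parity of their sum is that of k. Stating
  the hypothesis for 2e avoids division.\<close>

lemma theta_term_minus_powers:
  assumes "2 * e = int i * (k * (k + 1)) + int j * (k * (k - 1))"
  shows "theta_term (- (q ^ i)) (- (q ^ j)) k = alt_sign k * q ^ nat e"
proof -
  obtain u where u: "k * (k + 1) = 2 * u" "u \<ge> 0" by (rule triangular_int)
  obtain v where v: "k * (k - 1) = 2 * v" "v \<ge> 0"
    using triangular_int[of "k - 1"] by (metis diff_add_cancel mult.commute)
  have uv: "u = v + k" using u v by (simp add: algebra_simps)
  have e: "e = int i * u + int j * v" using assms unfolding u(1) v(1) by simp
  have ne: "nat e = i * nat u + j * nat v"
    unfolding e using u v by (simp add: nat_add_distrib nat_mult_distrib)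
  have "even (nat u + nat v) \<longleftrightarrow> even (u + v)"
    using u v by (simp add: even_nat_iff flip: nat_add_distrib)
  also have "\<dots> \<longleftrightarrow> even k" using uv by simp
  finally have "(-1) ^ (nat u + nat v) = alt_sign k"
    by (simp add: alt_sign_def)
  moreover have "theta_term (- (q ^ i)) (- (q ^ j)) k = (-1) ^ (nat u + nat v) * q ^ nat e"
    unfolding theta_term_def u(1) v(1) ne
    by (simp add: power_minus[of "q ^ i"] power_minus[of "q ^ j"] power_add mult_ac flip: power_mult)
  ultimately show ?thesis by simp
qed

lemma jacobi_triple_product_powers:
  assumes "norm q < 1" "i > 0" "j > 0"
    and e: "\<And>k. 2 * e k = int i * (k * (k + 1)) + int j * (k * (k - 1))"
  shows "((\<lambda>k. alt_sign k * q ^ nat (e k)) has_sum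
           (qpoch_inf (q ^ i) (q ^ (i + j)) * qpoch_inf (q ^ j) (q ^ (i + j))
              * qpoch_inf (q ^ (i + j)) (q ^ (i + j)))) UNIV"
proof -
  have "norm (- (q ^ n)) < 1" if "n > 0" for n
    using assms(1) norm_mult_power_less_1[of q "n - 1"] that by (simp flip: power_Suc)
  from jacobi_triple_product[OF this[OF assms(2)] this[OF assms(3)]]
  show ?thesis
    unfolding theta_term_minus_powers[OF e] by (simp add: power_add)
qed

lemma even_pentagonal: "even (3 * n\<^sup>2 + n :: int)" "even (3 * n\<^sup>2 - n :: int)"
  by auto

text \<open>The triple product with exponents (1, 2) and (2, 1), combined with the dissection modulo
  3. The two forms serve the classes Z = 6n - 1 and Z = 6n + 1.\<close>

lemma pentagonal_number_theorem:
  assumes "norm q < 1"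
  shows "((\<lambda>n. alt_sign n * q ^ nat ((3 * n\<^sup>2 - n) div 2)) has_sum qpoch_inf q q) UNIV"
    and "((\<lambda>n. alt_sign n * q ^ nat ((3 * n\<^sup>2 + n) div 2)) has_sum qpoch_inf q q) UNIV"
proof -
  have "qpoch_inf q q = qpoch_inf q (q ^ 3) * qpoch_inf (q ^ 2) (q ^ 3) * qpoch_inf (q ^ 3) (q ^ 3)"
    using qpoch_inf_dissect[OF assms, of 3 q] by (simp add: numeral_3_eq_3 numeral_2_eq_2)
  moreover have "2 * ((3 * n\<^sup>2 - n) div 2) = int 1 * (n * (n + 1)) + int 2 * (n * (n - 1))"
    "2 * ((3 * n\<^sup>2 + n) div 2) = int 2 * (n * (n + 1)) + int 1 * (n * (n - 1))" for n :: int
    using even_pentagonal[of n] by (simp_all add: algebra_simps power2_eq_square)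
  from jacobi_triple_product_powers[OF assms _ _ this(1)] jacobi_triple_product_powers[OF assms _ _ this(2)]
  show "((\<lambda>n. alt_sign n * q ^ nat ((3 * n\<^sup>2 - n) div 2)) has_sum qpoch_inf q q) UNIV"
    "((\<lambda>n. alt_sign n * q ^ nat ((3 * n\<^sup>2 + n) div 2)) has_sum qpoch_inf q q) UNIV"
    unfolding calculation by (simp_all add: power3_eq_cube power2_eq_square mult_ac)
qed

section \<open>The quadratic form \<open>W\<^sup>2 + 35 Z\<^sup>2\<close>\<close>

text \<open>The non-principal Dirichlet character modulo 4; \<open>chi3\<close> is its analogue
  modulo 3.\<close>

definition chi4 :: "int \<Rightarrow> complex" where
  "chi4 x = (if x mod 4 = 1 then 1 else if x mod 4 = 3 then -1 else 0)"

definition chi3 :: "int \<Rightarrow> complex" where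
  "chi3 x = (if x mod 3 = 1 then 1 else if x mod 3 = 2 then -1 else 0)"

lemma chi4_uminus: "chi4 (- x) = - chi4 x"
proof -
  have "(- x) mod 4 = (4 - x mod 4) mod 4" by presburger
  moreover have "x mod 4 \<in> {0, 1, 2, 3}" by auto
  ultimately show ?thesis by (auto simp: chi4_def)
qed

lemma norm_chi4_le: "norm (chi4 x) \<le> 1"
  by (simp add: chi4_def)

lemma alt_sign_diff: "alt_sign (n - m) = alt_sign n * alt_sign m"
  by (simp add: alt_sign_def)

lemma chi4_six: "chi4 (6 * n + 1) = alt_sign n" "chi4 (6 * n - 1) = - alt_sign n"
proof -
  have "(6 * n + 1) mod 4 = (if even n then 1 else 3)" "(6 * n - 1) mod 4 = (if even n then 3 else 1)"
    by presburger+
  then show "chi4 (6 * n + 1) = alt_sign n" "chi4 (6 * n - 1) = - alt_sign n"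
    by (auto simp: chi4_def alt_sign_def)
qed

text \<open>The sign identity for h and its translate. All terms depend only on k and l modulo 4,
  which leaves 16 cases.\<close>

lemma alt_sign_eq_chi4:
  "(if odd (k + l) then alt_sign k else 0) =
     - (chi4 (35 * k + 2) * chi4 (35 * k + 2 + 6 * l)) - chi4 (210 * k + 35 * l + 12) * chi4 l"
proof -
  define r s where "r = k mod 4" and "s = l mod 4"
  define a b where "a = k div 4" and "b = l div 4"
  have k: "k = 4 * a + r" and l: "l = 4 * b + s" by (simp_all add: r_def s_def a_def b_def)
  have "35 * k + 2 = 3 * r + 2 + 4 * (35 * a + 8 * r)"
    "35 * k + 2 + 6 * l = 3 * r + 2 + 2 * s + 4 * (35 * a + 8 * r + 6 * b + s)"
    "210 * k + 35 * l + 12 = 2 * r + 3 * s + 4 * (210 * a + 52 * r + 35 * b + 8 * s + 3)"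
    unfolding k l by simp_all
  then have m: "(35 * k + 2) mod 4 = (3 * r + 2) mod 4" "(35 * k + 2 + 6 * l) mod 4 = (3 * r + 2 + 2 * s) mod 4"
    "(210 * k + 35 * l + 12) mod 4 = (2 * r + 3 * s) mod 4"
    by (simp_all only: mod_mult_self2)
  have "even k \<longleftrightarrow> even r" "even l \<longleftrightarrow> even s" using k l by simp_all
  then have m': "l mod 4 = s" "even k \<longleftrightarrow> even r" "even (k + l) \<longleftrightarrow> even (r + s)"
    by (simp_all add: s_def)
  have "r \<in> {0, 1, 2, 3}" "s \<in> {0, 1, 2, 3}" by (auto simp: r_def s_def)
  then show ?thesis
    unfolding chi4_def alt_sign_def m m' by (elim insertE emptyE) simp_all
qed

text \<open>The division is exact only on the pairs \<open>(W, Z)\<close> that contribute; elsewhere it matters only that the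
  value depends on the norm \<open>N = W\<^sup>2 + 35 Z\<^sup>2\<close> alone.\<close>

definition norm_term :: "complex \<Rightarrow> int \<Rightarrow> complex" where
  "norm_term q N = q ^ nat ((N - 564) div 840)"

text \<open>The lattice W \<equiv> Z (mod 6) is parametrized by W and l through Z = W + 6l.\<close>

definition chi_term :: "complex \<Rightarrow> int \<Rightarrow> int \<Rightarrow> complex" where
  "chi_term q W l = chi4 W * chi4 (W + 6 * l) * norm_term q (W\<^sup>2 + 35 * (W + 6 * l)\<^sup>2)"

text \<open>A linear bound on the exponent suffices to compare the double series with a product of
  two geometric series.\<close>

lemma quadratic_form_lower_bound:
  fixes k l c :: int
  assumes "\<bar>c\<bar> \<le> 12"
  defines "W \<equiv> 35 * k + c"
  shows "\<bar>k\<bar> + \<bar>l\<bar> \<le> (W\<^sup>2 + 35 * (W + 6 * l)\<^sup>2 - 564) div 840 + 10"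
proof -
  define Z where "Z = W + 6 * l"
  have "35 * \<bar>k\<bar> \<le> \<bar>W\<bar> + 12" "6 * \<bar>l\<bar> \<le> \<bar>Z\<bar> + \<bar>W\<bar>"
    using assms by (auto simp: Z_def W_def)
  \<comment> \<open>Up to constants, 840 (|k| + |l|) is at most (24 + 140) |W| + 140 |Z|. The shifts
    82 = 164 / 2 and 2 are those for which W^2 and 35 Z^2 absorb these linear terms.\<close>
  moreover have "0 \<le> (\<bar>W\<bar> - 82)\<^sup>2" "0 \<le> (\<bar>Z\<bar> - 2)\<^sup>2" by auto
  then have "164 * \<bar>W\<bar> \<le> W\<^sup>2 + 6724" "4 * \<bar>Z\<bar> \<le> Z\<^sup>2 + 4"
    by (auto simp: power2_diff)
  moreover have "840 * (K + L) \<le> (A + 35 * B - 564) + 8400"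
    if "35 * K \<le> X + 12" "6 * L \<le> Y + X" "164 * X \<le> A + 6724" "4 * Y \<le> B + 4" for K L A B X Y :: int
  proof -
    have "840 * K \<le> 24 * X + 288" "840 * L \<le> 140 * Y + 140 * X" "140 * Y \<le> 35 * B + 140"
      using that by simp_all
    then show ?thesis using that(3) by simp
  qed
  ultimately have "840 * (\<bar>k\<bar> + \<bar>l\<bar>) \<le> (W\<^sup>2 + 35 * Z\<^sup>2 - 564) + 8400"
    by blast
  then have "840 * (\<bar>k\<bar> + \<bar>l\<bar> - 10) div 840 \<le> (W\<^sup>2 + 35 * Z\<^sup>2 - 564) div 840"
    by (intro zdiv_mono1) auto
  then show ?thesis by (simp add: Z_def)
qed

lemma summable_on_chi_term:
  assumes "norm q < 1" "\<bar>c\<bar> \<le> 12"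
  shows "(\<lambda>(k, l). chi_term q (35 * k + c) l) summable_on UNIV \<times> UNIV"
proof (rule abs_summable_summable, rule Infinite_Sum.abs_summable_on_comparison_test')
  \<comment> \<open>The floor 1/2 keeps r invertible when q = 0; the factor r^(-10) pays for the 10
    in the lower bound.\<close>
  define r where "r = max (norm q) (1 / 2)"
  have r: "norm q \<le> r" "0 < r" "r < 1" using assms by (auto simp: r_def)
  define h :: "int \<Rightarrow> real" where "h k = r ^ nat \<bar>k\<bar>" for k
  have h: "h summable_on UNIV"
    unfolding h_def using summable_on_power_abs_int r by auto
  then have "((\<lambda>k. complex_of_real (h k)) has_sum of_real (infsum h UNIV)) UNIV"
    by (intro has_sum_of_real) auto
  from has_sum_imp_summable[OF has_sum_mult_Times[OF this this]]
  have "(\<lambda>x. complex_of_real (h (fst x) * h (snd x))) summable_on UNIV \<times> UNIV"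
    by (simp add: case_prod_unfold)
  then have "(\<lambda>x. h (fst x) * h (snd x)) summable_on UNIV \<times> UNIV"
    using summable_on_Re by fastforce
  then show "(\<lambda>(k, l). inverse (r ^ 10) * (h k * h l)) summable_on UNIV \<times> UNIV"
    unfolding case_prod_unfold by (intro summable_on_cmult_right)
  show "norm (case x of (k, l) \<Rightarrow> chi_term q (35 * k + c) l)
      \<le> (case x of (k, l) \<Rightarrow> inverse (r ^ 10) * (h k * h l))" for x
  proof (cases x)
    case (Pair k l)
    define e where "e = ((35 * k + c)\<^sup>2 + 35 * (35 * k + c + 6 * l)\<^sup>2 - 564) div 840"
    have "norm (chi_term q (35 * k + c) l) \<le> 1 * 1 * norm q ^ nat e"
      unfolding chi_term_def norm_term_def e_def norm_mult norm_power
      by (intro mult_mono norm_chi4_le) auto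
    also have "\<dots> \<le> r ^ nat e" using r by (simp add: power_mono)
    also have "\<dots> = inverse (r ^ 10) * r ^ (nat e + 10)" using r by (simp add: power_add)
    also have "\<dots> \<le> inverse (r ^ 10) * r ^ (nat \<bar>k\<bar> + nat \<bar>l\<bar>)"
      using r quadratic_form_lower_bound[OF assms(2), of k l]
      by (intro mult_left_mono power_decreasing) (auto simp: e_def)
    finally show ?thesis by (simp add: Pair h_def power_add)
  qed
qed

lemma int_le_square: "x \<le> x\<^sup>2" for x :: int
proof (cases "x \<ge> 1")
  case False
  then show ?thesis using zero_le_power2[of x] by linarith
qed (simp add: self_le_power)

text \<open>Chinese remainder theorem for 840 = 8 * 3 * 35: 529 is congruent to 1, 1 and 4, and so
  is the square.\<close>

lemma square_mod_840:
  fixes W :: int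
  assumes "W\<^sup>2 mod 35 = 4" "odd W" "W mod 3 \<noteq> 0"
  obtains t where "t \<ge> 0" "W\<^sup>2 = 840 * t + 529"
proof -
  have "W\<^sup>2 mod 8 = ((W mod 8)\<^sup>2) mod 8" "W\<^sup>2 mod 3 = ((W mod 3)\<^sup>2) mod 3"
    by (simp_all add: power_mod)
  moreover have "W mod 8 \<in> {1, 3, 5, 7}" using assms(2) by (simp, presburger)
  moreover have "W mod 3 \<in> {1, 2}" using assms(3) by (simp, presburger)
  ultimately have "W\<^sup>2 mod 8 = 1" "W\<^sup>2 mod 3 = 1" by auto
  with assms(1) have "8 dvd W\<^sup>2 - 529" "3 dvd W\<^sup>2 - 529" "35 dvd W\<^sup>2 - 529"
    by (simp_all flip: mod_eq_dvd_iff)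
  then obtain a b c where "W\<^sup>2 - 529 = 8 * a" "W\<^sup>2 - 529 = 3 * b" "W\<^sup>2 - 529 = 35 * c"
    by (elim dvdE)
  \<comment> \<open>The coefficients come from the Bezout relation 105 * 33 - 280 * 11 - 24 * 16 = 1
    for the cofactors of 8, 3 and 35.\<close>
  then have "W\<^sup>2 - 529 = 840 * (11 * (3 * a - b) - 16 * c)" by simp
  then have "840 dvd W\<^sup>2 - 529" by (rule dvdI)
  then have "W\<^sup>2 mod 840 = 529" by (simp flip: mod_eq_dvd_iff)
  then have "W\<^sup>2 = 840 * (W\<^sup>2 div 840) + 529"
    using mult_div_mod_eq[of 840 "W\<^sup>2"] by simp
  then show ?thesis by (intro that[of "W\<^sup>2 div 840"]) (auto simp: pos_imp_zdiv_nonneg_iff)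
qed

text \<open>The inner sum over Z. For even W the factor \<open>chi4 W\<close> is zero; for W
  \<equiv> 3 (mod 6) the terms at Z and -Z cancel. Otherwise Z = 6n + 1 or Z = 6n - 1, where (Z^2 -
  1) / 24 is a generalized pentagonal number and \<open>chi4 Z\<close> is the matching sign up to a
  constant.\<close>

lemma has_sum_chi_term:
  assumes q: "norm q < 1" and W: "W\<^sup>2 mod 35 = 4"
    and summable: "chi_term q W summable_on UNIV"
  shows "(chi_term q W has_sum
           (chi4 W * chi3 W * q ^ nat ((W\<^sup>2 - 529) div 840) * qpoch_inf q q)) UNIV"
proof -
  have "even W \<or> W mod 6 = 3 \<or> W mod 6 = 1 \<or> W mod 6 = 5" by presburger
  then consider "even W" | "W mod 6 = 3" | "W mod 6 = 1" | "W mod 6 = 5" by blast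
  then show ?thesis
  proof cases
    case 1
    then have "W mod 4 \<noteq> 1" "W mod 4 \<noteq> 3" by presburger+
    then have "chi4 W = 0" by (simp add: chi4_def)
    then show ?thesis by (simp add: chi_term_def[abs_def])
  next
    case 2
    define w where "w = W div 6"
    have w: "W = 6 * w + 3" using 2 unfolding w_def by presburger
    define S where "S = infsum (chi_term q W) UNIV"
    have S: "(chi_term q W has_sum S) UNIV" using summable by (simp add: S_def)
    \<comment> \<open>This substitution in l is Z to -Z, and \<open>chi4\<close> is odd.\<close>
    have "chi_term q W (- l - 2 * w - 1) = - chi_term q W l" for l
    proof -
      have "W + 6 * (- l - 2 * w - 1) = - (W + 6 * l)" using w by simp
      then show ?thesis by (simp only: chi_term_def chi4_uminus power2_minus) simp
    qed
    then have "(chi_term q W has_sum - S) UNIV"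
      using has_sum_uminusI[OF S]
      by (subst (asm) has_sum_reindex_bij_witness[of UNIV "\<lambda>l. - l - 2 * w - 1" "\<lambda>l. - l - 2 * w - 1" UNIV "chi_term q W"])
        auto
    then have "S = 0" using S has_sum_unique by fastforce
    moreover have "W mod 3 = 0" using 2 by presburger
    then have "chi3 W = 0" by (simp add: chi3_def)
    ultimately show ?thesis using S by simp
  next
    case 3
    define w where "w = W div 6"
    have w: "W = 6 * w + 1" using 3 unfolding w_def by presburger
    have "odd W" "W mod 3 = 1" using 3 by presburger+
    then obtain t where t: "t \<ge> 0" "W\<^sup>2 = 840 * t + 529" using square_mod_840[OF W] by auto
    have ct: "chi_term q W l = chi4 W * q ^ nat t * (alt_sign (w + l) * q ^ nat ((3 * (w + l)\<^sup>2 + (w + l)) div 2))" for l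
    proof -
      define n where "n = w + l"
      have Z: "W + 6 * l = 6 * n + 1" using w by (simp add: n_def)
      obtain u where u: "3 * n\<^sup>2 + n = 2 * u" using even_pentagonal(1)[of n] by (elim evenE)
      have "0 \<le> n\<^sup>2 + n" using int_le_square[of "- n"] by simp
      then have u0: "0 \<le> u" using u zero_le_power2[of n] by linarith
      \<comment> \<open>Since 564 = 529 + 35, the exponent separates into a part t from W and a
        pentagonal part u from Z.\<close>
      have "W\<^sup>2 + 35 * (6 * n + 1)\<^sup>2 - 564 = 840 * (t + u)"
        using t u by (simp add: power2_eq_square algebra_simps)
      then have "norm_term q (W\<^sup>2 + 35 * (W + 6 * l)\<^sup>2) = q ^ nat t * q ^ nat u"
        unfolding norm_term_def Z using t u0 by (simp only:) (simp add: nat_add_distrib power_add)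
      then show ?thesis
        unfolding chi_term_def Z chi4_six using u by (simp flip: n_def)
    qed
    have "((\<lambda>l. alt_sign (w + l) * q ^ nat ((3 * (w + l)\<^sup>2 + (w + l)) div 2)) has_sum qpoch_inf q q) UNIV"
      using pentagonal_number_theorem(2)[OF q]
      by (subst has_sum_reindex_bij_witness[of UNIV "\<lambda>n. n - w" "\<lambda>l. w + l" UNIV
            "\<lambda>n. alt_sign n * q ^ nat ((3 * n\<^sup>2 + n) div 2)"]) auto
    from has_sum_cmult_right[OF this, of "chi4 W * q ^ nat t"]
    have "(chi_term q W has_sum (chi4 W * q ^ nat t * qpoch_inf q q)) UNIV"
      by (simp only: ct[symmetric])
    then show ?thesis using t \<open>W mod 3 = 1\<close> by (simp add: chi3_def)
  next
    case 4
    define w where "w = W div 6 + 1"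
    have w: "W = 6 * w - 1" using 4 unfolding w_def by presburger
    have "odd W" "W mod 3 = 2" using 4 by presburger+
    then obtain t where t: "t \<ge> 0" "W\<^sup>2 = 840 * t + 529" using square_mod_840[OF W] by auto
    have ct: "chi_term q W l = - chi4 W * q ^ nat t * (alt_sign (w + l) * q ^ nat ((3 * (w + l)\<^sup>2 - (w + l)) div 2))" for l
    proof -
      define n where "n = w + l"
      have Z: "W + 6 * l = 6 * n - 1" using w by (simp add: n_def)
      obtain u where u: "3 * n\<^sup>2 - n = 2 * u" using even_pentagonal(2)[of n] by (elim evenE)
      have "0 \<le> n\<^sup>2 - n" using int_le_square[of n] by simp
      then have u0: "0 \<le> u" using u zero_le_power2[of n] by linarith
      have "W\<^sup>2 + 35 * (6 * n - 1)\<^sup>2 - 564 = 840 * (t + u)"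
        using t u by (simp add: power2_eq_square algebra_simps)
      then have "norm_term q (W\<^sup>2 + 35 * (W + 6 * l)\<^sup>2) = q ^ nat t * q ^ nat u"
        unfolding norm_term_def Z using t u0 by (simp only:) (simp add: nat_add_distrib power_add)
      then show ?thesis
        unfolding chi_term_def Z chi4_six using u by (simp flip: n_def)
    qed
    have "((\<lambda>l. alt_sign (w + l) * q ^ nat ((3 * (w + l)\<^sup>2 - (w + l)) div 2)) has_sum qpoch_inf q q) UNIV"
      using pentagonal_number_theorem(1)[OF q]
      by (subst has_sum_reindex_bij_witness[of UNIV "\<lambda>n. n - w" "\<lambda>l. w + l" UNIV
            "\<lambda>n. alt_sign n * q ^ nat ((3 * n\<^sup>2 - n) div 2)"]) auto
    from has_sum_cmult_right[OF this, of "- chi4 W * q ^ nat t"]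
    have "(chi_term q W has_sum (- chi4 W * q ^ nat t * qpoch_inf q q)) UNIV"
      by (simp only: ct[symmetric])
    then show ?thesis using t \<open>W mod 3 = 2\<close> by (simp add: chi3_def)
  qed
qed

section \<open>The product of the theta functions in bases q^5 and q^7 as a double series\<close>

definition theta57 :: "complex \<Rightarrow> complex" where
  "theta57 q = qpochs_inf [q, q ^ 4, q ^ 5] (q ^ 5) * qpochs_inf [q, q ^ 6, q ^ 7] (q ^ 7)"

text \<open>For the summation indices n and m of the two triple products, X = 10n - 3 and Y = 14m -
  5. Then W = 35k + 2 with k = n - m, and Z = 5n + 7m - 4 = W + 6l; the pairs (k, l) obtained are
  exactly those with k + l odd.\<close>

lemma has_sum_theta57:
  assumes "norm q < 1"
  shows "((\<lambda>(k, l). if odd (k + l) then alt_sign k * norm_term q ((35 * k + 2)\<^sup>2 + 35 * (35 * k + 2 + 6 * l)\<^sup>2) else 0)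
           has_sum theta57 q) (UNIV \<times> UNIV)"
proof -
  have e5: "even (5 * n\<^sup>2 - 3 * n)" and e7: "even (7 * n\<^sup>2 - 5 * n)" for n :: int by auto
  define f where "f n = alt_sign n * q ^ nat ((5 * n\<^sup>2 - 3 * n) div 2)" for n
  define g where "g n = alt_sign n * q ^ nat ((7 * n\<^sup>2 - 5 * n) div 2)" for n
  define F where "F = (\<lambda>(k, l). alt_sign k * norm_term q ((35 * k + 2)\<^sup>2 + 35 * (35 * k + 2 + 6 * l)\<^sup>2))"
  have "(f has_sum qpochs_inf [q, q ^ 4, q ^ 5] (q ^ 5)) UNIV"
    using jacobi_triple_product_powers[OF assms, of 1 4 "\<lambda>n. (5 * n\<^sup>2 - 3 * n) div 2"] e5
    by (simp add: f_def[abs_def] qpochs_inf_def algebra_simps power2_eq_square)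
  moreover have "(g has_sum qpochs_inf [q, q ^ 6, q ^ 7] (q ^ 7)) UNIV"
    using jacobi_triple_product_powers[OF assms, of 1 6 "\<lambda>n. (7 * n\<^sup>2 - 5 * n) div 2"] e7
    by (simp add: g_def[abs_def] qpochs_inf_def algebra_simps power2_eq_square)
  ultimately have fg: "((\<lambda>(n, m). f n * g m) has_sum theta57 q) (UNIV \<times> UNIV)"
    unfolding theta57_def by (rule has_sum_mult_Times)
  have Ffg: "F (n - m, 2 * m - 5 * (n - m) - 1) = f n * g m" for n m
  proof -
    obtain u where u: "5 * n\<^sup>2 - 3 * n = 2 * u" using e5[of n] by (elim evenE)
    obtain v where v: "7 * m\<^sup>2 - 5 * m = 2 * v" using e7[of m] by (elim evenE)
    have uv: "u \<ge> 0" "v \<ge> 0"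
      using u v int_le_square[of n] int_le_square[of m] zero_le_power2[of n] zero_le_power2[of m] by linarith+
    have "(35 * (n - m) + 2)\<^sup>2 + 35 * (35 * (n - m) + 2 + 6 * (2 * m - 5 * (n - m) - 1))\<^sup>2 - 564
        = 420 * (5 * n\<^sup>2 - 3 * n) + 420 * (7 * m\<^sup>2 - 5 * m)"
      by (simp add: power2_eq_square algebra_simps)
    also have "\<dots> = 840 * (u + v)" unfolding u v by simp
    finally have "norm_term q ((35 * (n - m) + 2)\<^sup>2 + 35 * (35 * (n - m) + 2 + 6 * (2 * m - 5 * (n - m) - 1))\<^sup>2)
        = q ^ nat u * q ^ nat v"
      using uv by (simp add: norm_term_def nat_add_distrib power_add)
    then show ?thesis
      unfolding F_def f_def g_def u v by (simp add: alt_sign_diff mult_ac)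
  qed
  have half: "1 + (2 * ((l + 5 * k) div 2) - 5 * k) = l" if "odd k = even l" for k l :: int
  proof -
    have "odd (l + 5 * k)" using that by auto
    from odd_two_times_div_two_succ[OF this] show ?thesis by linarith
  qed
  have "(F has_sum theta57 q) {(k, l). odd (k + l)}"
    using fg
    by (subst (asm) has_sum_reindex_bij_witness[of _
          "\<lambda>(k, l). (k + (l + 5 * k + 1) div 2, (l + 5 * k + 1) div 2)"
          "\<lambda>(n, m). (n - m, 2 * m - 5 * (n - m) - 1)" "{(k, l). odd (k + l)}" F])
       (use half in \<open>auto simp: Ffg[simplified]\<close>)
  then show ?thesis
    by (subst (asm) has_sum_cong_neutral[where T = "UNIV \<times> UNIV"]) (auto simp: F_def split: if_splits)
qed

text \<open>What the inner sum leaves beside (q; q)_inf. The product of \<open>chi4\<close> and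
  \<open>chi3\<close> is the even quadratic character modulo 12.\<close>

definition unary_term :: "complex \<Rightarrow> int \<Rightarrow> complex" where
  "unary_term q W = chi4 W * chi3 W * q ^ nat ((W\<^sup>2 - 529) div 840)"

text \<open>The second term is the first one evaluated at \<open>(1 - \<surd>-35) / 6 \<cdot> (W + \<surd>-35 Z)\<close> with \<open>W = 35 k + 2\<close>, \<open>Z = W + 6 l\<close>.\<close>

lemma theta57_eq_chi_term:
  fixes k l :: int
  shows "(if odd (k + l) then alt_sign k * norm_term q ((35 * k + 2)\<^sup>2 + 35 * (35 * k + 2 + 6 * l)\<^sup>2) else 0)
    = - chi_term q (35 * k + 2) l
      - chi4 (210 * k + 35 * l + 12) * chi4 l * norm_term q ((210 * k + 35 * l + 12)\<^sup>2 + 35 * l\<^sup>2)"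
proof -
  have N: "(210 * k + 35 * l + 12)\<^sup>2 + 35 * l\<^sup>2 = (35 * k + 2)\<^sup>2 + 35 * (35 * k + 2 + 6 * l)\<^sup>2"
    by (simp add: power2_eq_square algebra_simps)
  have mult: "(if odd (k + l) then alt_sign k * x else 0) = (if odd (k + l) then alt_sign k else 0) * x" for x
    by simp
  show ?thesis
    unfolding N chi_term_def by (subst mult, subst alt_sign_eq_chi4) (simp add: algebra_simps)
qed

text \<open>Both parts of the split double series are sums of \<open>chi_term\<close>, over W
  \<equiv> 2 and W \<equiv> 12 modulo 35; summing over Z first extracts the common factor (q;
  q)_inf.\<close>

lemma theta57_unary:
  assumes q: "norm q < 1"
  obtains S T where "((\<lambda>k. unary_term q (35 * k + 2)) has_sum S) UNIV"
    "((\<lambda>k. unary_term q (35 * k + 12)) has_sum T) UNIV"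
    "theta57 q = (T - S) * qpoch_inf q q"
proof -
  define E where "E = qpoch_inf q q"
  have E: "E \<noteq> 0" using qpoch_inf_self_nonzero[OF q] by (simp add: E_def)
  have unary: "\<exists>S. ((\<lambda>(k, l). chi_term q (35 * k + c) l) has_sum S * E) (UNIV \<times> UNIV) \<and>
      ((\<lambda>k. unary_term q (35 * k + c)) has_sum S) UNIV" if c: "c\<^sup>2 mod 35 = 4" "\<bar>c\<bar> \<le> 12" for c
  proof -
    have sm: "(\<lambda>(k, l). chi_term q (35 * k + c) l) summable_on UNIV \<times> UNIV"
      using q c by (intro summable_on_chi_term)
    \<comment> \<open>Dividing by the nonzero E lets convergence of the unary series follow from
      that of the double series.\<close>
    define S where "S = infsum (\<lambda>(k, l). chi_term q (35 * k + c) l) (UNIV \<times> UNIV) / E"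
    have S: "((\<lambda>(k, l). chi_term q (35 * k + c) l) has_sum S * E) (UNIV \<times> UNIV)"
      using sm E by (simp add: S_def)
    have "((\<lambda>l. chi_term q (35 * k + c) l) has_sum unary_term q (35 * k + c) * E) UNIV" for k
      unfolding unary_term_def E_def
    proof (rule has_sum_chi_term[OF q])
      have "(35 * k + c)\<^sup>2 = c\<^sup>2 + 35 * (35 * k\<^sup>2 + 2 * k * c)"
        by (simp add: power2_eq_square algebra_simps)
      then show "(35 * k + c)\<^sup>2 mod 35 = 4" using c by (simp only: mod_mult_self2)
      show "chi_term q (35 * k + c) summable_on UNIV"
        using summable_on_SigmaD1[OF sm, of k] by simp
    qed
    with S have "((\<lambda>k. unary_term q (35 * k + c) * E) has_sum S * E) UNIV"
      by (intro has_sum_SigmaD[OF S]) auto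
    then have "((\<lambda>k. unary_term q (35 * k + c)) has_sum S) UNIV"
      using E by (simp add: has_sum_cmult_left_iff)
    with S show ?thesis by blast
  qed
  obtain S where S: "((\<lambda>(k, l). chi_term q (35 * k + 2) l) has_sum S * E) (UNIV \<times> UNIV)"
      "((\<lambda>k. unary_term q (35 * k + 2)) has_sum S) UNIV"
    using unary[of 2] by auto
  obtain T where T: "((\<lambda>(k, l). chi_term q (35 * k + 12) l) has_sum T * E) (UNIV \<times> UNIV)"
      "((\<lambda>k. unary_term q (35 * k + 12)) has_sum T) UNIV"
    using unary[of 12] by auto
  define B where "B = (\<lambda>(k, l). chi4 (210 * k + 35 * l + 12) * chi4 l *
      norm_term q ((210 * k + 35 * l + 12)\<^sup>2 + 35 * l\<^sup>2))"
  \<comment> \<open>In the translated term W = 35(6k + l) + 12, so j = 6k + l, and Z = -l is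
    congruent to W modulo 6. Oddness of \<open>chi4\<close> turns the minus sign into a
    plus.\<close>
  have B: "- B (6 * j + 2 + i, - (35 * j + 12 + 6 * i)) = chi_term q (35 * j + 12) i" for j i
  proof -
    have "210 * (6 * j + 2 + i) + 35 * - (35 * j + 12 + 6 * i) + 12 = 35 * j + 12" by simp
    then show ?thesis
      unfolding B_def chi_term_def prod.case chi4_uminus power2_minus by (simp only:) simp
  qed
  have "((\<lambda>x. - B x) has_sum T * E) (UNIV \<times> UNIV)"
    using T(1)
    by (subst (asm) has_sum_reindex_bij_witness[of _
          "\<lambda>(k, l). (6 * k + l, k - 6 * (6 * k + l) - 2)"
          "\<lambda>(j, i). (6 * j + 2 + i, - (35 * j + 12 + 6 * i))" "UNIV \<times> UNIV" "\<lambda>x. - B x"])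
       (auto simp: B simp del: minus_add_distrib)
  from has_sum_add[OF has_sum_uminusI[OF S(1)] this]
  have "((\<lambda>(k, l). - chi_term q (35 * k + 2) l - B (k, l)) has_sum (- (S * E) + T * E)) (UNIV \<times> UNIV)"
    by (simp add: case_prod_unfold)
  moreover have "((\<lambda>(k, l). - chi_term q (35 * k + 2) l - B (k, l)) has_sum theta57 q) (UNIV \<times> UNIV)"
    using has_sum_theta57[OF q] unfolding theta57_eq_chi_term B_def by simp
  ultimately have "theta57 q = - (S * E) + T * E" using has_sum_unique by blast
  then show ?thesis using that S(2) T(2) by (simp add: E_def algebra_simps)
qed

section \<open>The exponent sequence\<close>

text \<open>The square roots of 529 modulo 840, reduced modulo 420.\<close>

definition root_residues :: "nat list" where
  "root_residues = [23, 37, 47, 103, 107, 163, 173, 187, 233, 247, 257, 313, 317, 373, 383, 397]"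

text \<open>Lists the positive x with x^2 \<equiv> 529 (mod 840). Adding 420 to x does not change
  its square modulo 840, so there are 16 roots per block of 420, in step with the period of
  \<open>t_sign\<close>.\<close>

definition root_seq :: "nat \<Rightarrow> nat" where
  "root_seq n = 420 * (n div 16) + root_residues ! (n mod 16)"

lemma less_16_cases:
  fixes r :: nat
  assumes "r < 16"
  shows "r \<in> {0, 1, 2, 3, 4, 5, 6, 7, 8, 9, 10, 11, 12, 13, 14, 15}"
  using assms by simp presburger

lemma root_less_Suc: "root_seq n < root_seq (Suc n)"
proof -
  have "n mod 16 \<in> {0, 1, 2, 3, 4, 5, 6, 7, 8, 9, 10, 11, 12, 13, 14, 15}"
    by (rule less_16_cases) simp
  then show ?thesis
    unfolding root_seq_def root_residues_def
    by (elim insertE emptyE) (simp_all add: mod_Suc div_Suc)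
qed

lemma root_square: "\<exists>t. (root_seq n)\<^sup>2 = 840 * t + 529"
proof -
  define d where "d = n div 16"
  have "n mod 16 \<in> {0, 1, 2, 3, 4, 5, 6, 7, 8, 9, 10, 11, 12, 13, 14, 15}"
    by (rule less_16_cases) simp
  then obtain t where t: "(root_residues ! (n mod 16))\<^sup>2 = 840 * t + 529"
    unfolding root_residues_def
    by (elim insertE emptyE) simp_all
  show ?thesis
    by (rule exI[of _ "210 * d\<^sup>2 + d * root_residues ! (n mod 16) + t"])
       (simp add: root_seq_def t power2_sum d_def algebra_simps power_mult_distrib)
qed

lemma strict_mono_root: "strict_mono root_seq"
  using root_less_Suc by (simp add: strict_mono_Suc_iff)

lemma root_residues_complete:
  "list_all (\<lambda>r. r * r mod 840 = 529 \<longrightarrow> r \<in> set root_residues) [0..<420]"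
  by (simp add: upt_rec[of 0] upt_rec[of "Suc 0"] upt_rec_numeral root_residues_def flip: numeral_2_eq_2)

lemma square_imp_root:
  fixes x :: nat
  assumes "x\<^sup>2 = 840 * m + 529"
  obtains n where "x = root_seq n"
proof -
  define r d where "r = x mod 420" and "d = x div 420"
  have x: "x = r + 420 * d" by (simp add: r_def d_def)
  have "x\<^sup>2 = r * r + 840 * (r * d + 210 * d\<^sup>2)"
    by (simp add: x power2_eq_square algebra_simps)
  then have "x\<^sup>2 mod 840 = r * r mod 840" by (simp only: mod_mult_self2)
  moreover have "x\<^sup>2 mod 840 = 529" by (simp add: assms)
  moreover have "r \<in> set [0..<420]" by (simp add: r_def)
  ultimately have "r \<in> set root_residues"
    using root_residues_complete unfolding list_all_iff by metis
  then obtain i where "i < length root_residues" and r: "r = root_residues ! i"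
    by (metis in_set_conv_nth)
  then have "i < 16" by (simp add: root_residues_def)
  then have "x = root_seq (16 * d + i)" by (simp add: root_seq_def x flip: r)
  then show ?thesis by (rule that)
qed

text \<open>If f and g agree below n, then g n is some f i with i \<ge> n, so f n \<le> g n; the
  converse is symmetric.\<close>

lemma strict_mono_eqI:
  fixes f g :: "nat \<Rightarrow> nat"
  assumes "strict_mono f" "strict_mono g" "range f = range g"
  shows "f = g"
proof
  have le: "f n \<le> g n"
    if f: "strict_mono f" and g: "strict_mono g" and fg: "range f = range g" "\<And>m. m < n \<Longrightarrow> f m = g m"
    for f g :: "nat \<Rightarrow> nat" and n
  proof -
    obtain i where i: "g n = f i" using fg(1) by (metis rangeE rangeI)
    have "\<not> i < n"
    proof
      assume "i < n"
      then show False using fg(2)[of i] i strict_monoD[OF g, of i n] by simp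
    qed
    then show ?thesis using i strict_mono_less_eq[OF f] by simp
  qed
  show "f n = g n" for n
  proof (induction n rule: less_induct)
    case (less n)
    have "f n \<le> g n" by (rule le[OF assms]) (rule less)
    moreover have "g n \<le> f n"
      by (rule le[OF assms(2,1) assms(3)[symmetric]]) (rule less[symmetric])
    ultimately show ?case by (rule antisym)
  qed
qed

text \<open>The quotients ((root_seq n)^2 - 529) / 840 increase strictly and have range
  \<open>square_indices\<close>, as does \<open>a_seq\<close>.\<close>

lemma a_seq_root: "(root_seq n)\<^sup>2 = 840 * a_seq n + 529"
proof -
  obtain v where v: "\<And>n. (root_seq n)\<^sup>2 = 840 * v n + 529" using root_square by metis
  have "strict_mono v"
  proof (rule strict_monoI)
    fix m n :: nat assume "m < n"
    then have "(root_seq m)\<^sup>2 < (root_seq n)\<^sup>2"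
      using strict_monoD[OF strict_mono_root] by (intro power_strict_mono) auto
    then show "v m < v n" by (simp add: v)
  qed
  moreover have "range v = square_indices"
  proof (intro equalityI subsetI)
    fix m assume "m \<in> range v"
    then obtain n where "m = v n" by auto
    then have "840 * m + 529 = (root_seq n)\<^sup>2" by (simp add: v)
    then show "m \<in> square_indices" unfolding square_indices_def by (auto intro: is_nth_powerI)
  next
    fix m assume "m \<in> square_indices"
    then obtain x where x: "x\<^sup>2 = 840 * m + 529"
      unfolding square_indices_def is_nth_power_def by auto
    then obtain n where "x = root_seq n" by (rule square_imp_root)
    with x have "m = v n" using v[of n] by simp
    then show "m \<in> range v" by simp
  qed
  ultimately have "a_seq = v"
    using strict_mono_a_seq range_a_seq by (intro strict_mono_eqI) auto
  then show ?thesis by (simp add: v)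
qed

text \<open>Of the two roots \<open>\<plusminus>root_seq n\<close>, exactly one lies in the residue classes 2 and 12 modulo 35.\<close>

definition signed_root :: "nat \<Rightarrow> int" where
  "signed_root n = (if root_seq n mod 35 \<in> {2, 12} then int (root_seq n) else - int (root_seq n))"

lemma signed_root_power2: "(signed_root n)\<^sup>2 = 840 * int (a_seq n) + 529"
proof -
  have "(signed_root n)\<^sup>2 = int ((root_seq n)\<^sup>2)" by (simp add: signed_root_def)
  then show ?thesis by (simp add: a_seq_root)
qed

text \<open>The moduli 35, 4, 3 and 2 all divide 420, so everything depends on n mod 16 alone and is
  checked on one period.\<close>

lemma signed_root_residues:
  defines "W \<equiv> signed_root"
  shows "W n mod 35 \<in> {2, 12}" "odd (W n)" "W n mod 3 \<noteq> 0"
    "(if W n mod 35 = 12 then 1 else -1) * (chi4 (W n) * chi3 (W n)) = (-1) ^ t_sign n"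
proof -
  define d c where "d = n div 16" and "c = root_residues ! (n mod 16)"
  have r: "root_seq n = c + 420 * d" by (simp add: root_seq_def c_def d_def)
  define C where "C = (if c mod 35 \<in> {2, 12} then int c else - int c)"
  have "root_seq n = c + 35 * (12 * d)" using r by simp
  then have "root_seq n mod 35 = c mod 35" by (simp only: mod_mult_self2)
  then have "\<exists>e. W n = C + 420 * e"
    unfolding W_def signed_root_def C_def using r
    by (auto intro: exI[of _ "int d"] exI[of _ "- int d"])
  then obtain e where e: "W n = C + 420 * e" ..
  have m: "W n mod k = C mod k" if "420 = k * l" for k l
  proof -
    have "W n = C + k * (l * e)" using e that by (simp flip: mult.assoc)
    then show ?thesis by (simp only: mod_mult_self2)
  qed
  have m: "W n mod 35 = C mod 35" "W n mod 4 = C mod 4" "W n mod 3 = C mod 3" "W n mod 2 = C mod 2"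
    by (rule m[of 35 12] m[of 4 105] m[of 3 140] m[of 2 210]; simp)+
  have "n mod 16 \<in> {0, 1, 2, 3, 4, 5, 6, 7, 8, 9, 10, 11, 12, 13, 14, 15}"
    by (rule less_16_cases) simp
  then have "(n mod 16, C) \<in> {(0, - 23), (1, 37), (2, 47), (3, - 103), (4, 107), (5, - 163), (6, - 173), (7, 187),
      (8, - 233), (9, 247), (10, 257), (11, - 313), (12, 317), (13, - 373), (14, - 383), (15, 397)}"
    by (elim insertE emptyE) (simp_all add: C_def c_def root_residues_def)
  then have C: "C mod 35 \<in> {2, 12} \<and> C mod 2 = 1 \<and> C mod 3 \<noteq> 0 \<and>
      (if C mod 35 = 12 then 1 else -1) *
        ((if C mod 4 = 1 then 1 else if C mod 4 = 3 then -1 else 0) *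
         (if C mod 3 = 1 then 1 else if C mod 3 = 2 then -1 else 0)) = (-1 :: complex) ^ t_sign n"
    unfolding t_sign_def by (elim insertE emptyE Pair_inject) simp_all
  show "W n mod 35 \<in> {2, 12}" unfolding m by (rule C[THEN conjunct1])
  show "odd (W n)" unfolding odd_iff_mod_2_eq_one m by (rule C[THEN conjunct2, THEN conjunct1])
  show "W n mod 3 \<noteq> 0" unfolding m by (rule C[THEN conjunct2, THEN conjunct2, THEN conjunct1])
  show "(if W n mod 35 = 12 then 1 else -1) * (chi4 (W n) * chi3 (W n)) = (-1) ^ t_sign n"
    unfolding chi4_def chi3_def m by (rule C[THEN conjunct2, THEN conjunct2, THEN conjunct2])
qed

text \<open>Absolute values recover \<open>root_seq\<close>, which gives injectivity. For
  surjectivity, \<open>square_mod_840\<close> makes |W| a root, and its sign is forced because -2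
  and -12 lie in the classes 33 and 23 modulo 35.\<close>

lemma bij_betw_signed_root:
  "bij_betw signed_root UNIV {W. W mod 35 \<in> {2, 12} \<and> odd W \<and> W mod 3 \<noteq> 0}"
proof (rule bij_betw_imageI)
  have "nat \<bar>signed_root n\<bar> = root_seq n" for n by (simp add: signed_root_def)
  then show "inj signed_root"
    by (metis injI strict_mono_root strict_mono_eq)
  show "range signed_root = {W. W mod 35 \<in> {2, 12} \<and> odd W \<and> W mod 3 \<noteq> 0}"
  proof (intro equalityI subsetI)
    fix W :: int assume "W \<in> {W. W mod 35 \<in> {2, 12} \<and> odd W \<and> W mod 3 \<noteq> 0}"
    then have W: "W mod 35 = 2 \<or> W mod 35 = 12" "odd W" "W mod 3 \<noteq> 0" by auto
    have "W\<^sup>2 mod 35 = (W mod 35)\<^sup>2 mod 35" by (simp add: power_mod)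
    then have "W\<^sup>2 mod 35 = 4" using W(1) by auto
    then obtain t where t: "t \<ge> 0" "W\<^sup>2 = 840 * t + 529" using W square_mod_840 by metis
    have "int ((nat \<bar>W\<bar>)\<^sup>2) = int (840 * nat t + 529)" using t by simp
    then have "(nat \<bar>W\<bar>)\<^sup>2 = 840 * nat t + 529" by (simp only: of_nat_eq_iff)
    then obtain n where n: "nat \<bar>W\<bar> = root_seq n" by (rule square_imp_root)
    have "W = signed_root n"
    proof (cases "W \<ge> 0")
      case True
      then have "int (root_seq n) = W" using n by simp
      moreover from this have "int (root_seq n mod 35) = W mod 35" by (simp add: zmod_int)
      with W(1) have "root_seq n mod 35 = 2 \<or> root_seq n mod 35 = 12" by linarith
      ultimately show ?thesis by (auto simp: signed_root_def)
    next
      case False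
      then have "int (root_seq n) = - W" using n by simp
      moreover from this have "int (root_seq n mod 35) = 35 - W mod 35"
        using W(1) by (auto simp: zmod_int zmod_zminus1_eq_if)
      with W(1) have "root_seq n mod 35 \<noteq> 2 \<and> root_seq n mod 35 \<noteq> 12" by linarith
      ultimately show ?thesis by (auto simp: signed_root_def)
    qed
    then show "W \<in> range signed_root" by simp
  next
    fix W assume "W \<in> range signed_root"
    then obtain n where "W = signed_root n" by blast
    then show "W \<in> {W. W mod 35 \<in> {2, 12} \<and> odd W \<and> W mod 3 \<noteq> 0}"
      using signed_root_residues(1-3)[of n] by (intro CollectI conjI) simp_all
  qed
qed

section \<open>Assembling the series over the sequence\<close>

lemma unary_term_neutral:
  assumes "even W \<or> W mod 3 = 0"
  shows "unary_term q W = 0"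
proof -
  have "W mod 4 \<noteq> 1 \<and> W mod 4 \<noteq> 3" if "even W" using that by presburger
  then show ?thesis using assms by (auto simp: unary_term_def chi4_def chi3_def)
qed

text \<open>The two progressions are merged with weight +1 on the class 12 and -1 on the class 2,
  the vanishing terms are dropped, and \<open>signed_root\<close> reindexes the rest.\<close>

lemma has_sum_a_seq:
  assumes S: "((\<lambda>k. unary_term q (35 * k + 2)) has_sum S) UNIV"
    and T: "((\<lambda>k. unary_term q (35 * k + 12)) has_sum T) UNIV"
  shows "((\<lambda>n. (-1) ^ t_sign n * q ^ a_seq n) has_sum (T - S)) UNIV"
proof -
  have div35: "35 * (W div 35) + c = W" if "W mod 35 = c" for W c :: int
    using mult_div_mod_eq[of 35 W] that by simp
  define v where "v W = (if W mod 35 = 12 then 1 else -1) * unary_term q W" for W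
  have "((\<lambda>k. - unary_term q (35 * k + 2)) has_sum (- S)) UNIV"
    using S by (rule has_sum_uminusI)
  then have "(v has_sum (- S)) {W. W mod 35 = 2}"
    by (subst (asm) has_sum_reindex_bij_witness[of _ "\<lambda>W. W div 35" "\<lambda>k. 35 * k + 2" "{W. W mod 35 = 2}" v])
       (auto simp: v_def div35)
  moreover have "(v has_sum T) {W. W mod 35 = 12}"
    using T
    by (subst (asm) has_sum_reindex_bij_witness[of _ "\<lambda>W. W div 35" "\<lambda>k. 35 * k + 12" "{W. W mod 35 = 12}" v])
       (auto simp: v_def div35)
  ultimately have "(v has_sum (- S + T)) ({W. W mod 35 = 2} \<union> {W. W mod 35 = 12})"
    by (intro has_sum_Un_disjoint) auto
  then have "(v has_sum (T - S)) {W. W mod 35 \<in> {2, 12} \<and> odd W \<and> W mod 3 \<noteq> 0}"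
    by (subst (asm) has_sum_cong_neutral[where T = "{W. W mod 35 \<in> {2, 12} \<and> odd W \<and> W mod 3 \<noteq> 0}"])
       (auto simp: v_def unary_term_neutral)
  then have "((\<lambda>n. v (signed_root n)) has_sum (T - S)) UNIV"
    by (subst has_sum_reindex_bij_betw[OF bij_betw_signed_root])
  moreover have "v (signed_root n) = (-1) ^ t_sign n * q ^ a_seq n" for n
    using signed_root_residues(4)[of n]
    by (simp add: v_def unary_term_def signed_root_power2 flip: mult.assoc)
  ultimately show ?thesis by simp
qed

theorem theorem2:
  fixes q :: complex
  assumes "norm q < 1"
  shows "(\<lambda>n. (-1) ^ t_sign n * q ^ a_seq n) sums
           (qpochs_inf [q, q ^ 6, q ^ 7] (q ^ 7) / qpochs_inf [q ^ 2, q ^ 3] (q ^ 5))"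
proof -
  obtain S T where ST: "((\<lambda>k. unary_term q (35 * k + 2)) has_sum S) UNIV"
    "((\<lambda>k. unary_term q (35 * k + 12)) has_sum T) UNIV"
    "theta57 q = (T - S) * qpoch_inf q q"
    using theta57_unary[OF assms] .
  \<comment> \<open>Dissection modulo 5 exhibits the denominator as the cofactor of the base q^5
    theta product, which is nonzero and cancels.\<close>
  have "qpoch_inf q q = (\<Prod>j<5. qpoch_inf (q * q ^ j) (q ^ 5))"
    using assms by (rule qpoch_inf_dissect) simp
  also have "\<dots> = qpochs_inf [q, q ^ 4, q ^ 5] (q ^ 5) * qpochs_inf [q ^ 2, q ^ 3] (q ^ 5)"
    by (simp add: qpochs_inf_def lessThan_nat_numeral lessThan_Suc mult_ac flip: power_Suc numeral_2_eq_2)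
  finally have E: "qpoch_inf q q = \<dots>" .
  have "qpoch_inf q q \<noteq> 0" using assms by (rule qpoch_inf_self_nonzero)
  then have nz: "qpochs_inf [q, q ^ 4, q ^ 5] (q ^ 5) \<noteq> 0" "qpochs_inf [q ^ 2, q ^ 3] (q ^ 5) \<noteq> 0"
    unfolding E by auto
  have "qpochs_inf [q, q ^ 4, q ^ 5] (q ^ 5) * qpochs_inf [q, q ^ 6, q ^ 7] (q ^ 7) =
      qpochs_inf [q, q ^ 4, q ^ 5] (q ^ 5) * ((T - S) * qpochs_inf [q ^ 2, q ^ 3] (q ^ 5))"
    using ST(3) unfolding theta57_def E by (simp only: mult_ac)
  then have "qpochs_inf [q, q ^ 6, q ^ 7] (q ^ 7) = (T - S) * qpochs_inf [q ^ 2, q ^ 3] (q ^ 5)"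
    using nz(1) by simp
  then have "T - S = qpochs_inf [q, q ^ 6, q ^ 7] (q ^ 7) / qpochs_inf [q ^ 2, q ^ 3] (q ^ 5)"
    using nz(2) by simp
  then show ?thesis
    using has_sum_imp_sums[OF has_sum_a_seq[OF ST(1,2)]] by simp
qed

end
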